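(* Let $\langle\cdot,\cdot\rangle$ be an arbitrary inner product on $\mathbb{R}^n$ with induced norm $\|\cdot\|$; averagedness and proximal operators are taken in $(\mathbb{R}^n,\langle\cdot,\cdot\rangle)$. Let $f:\mathbb{R}^n\to\mathbb{R}$ and $D:\mathbb{R}^n\to\mathbb{R}^n$ (not necessarily linear), and let $\rho>0$ be arbitrary. Define $$T_{\mathrm{ADMM}}=\tfrac12 I+\tfrac12\,(2\,\mathrm{Prox}_{\rho^{-1}f}-I)\circ(2D-I).$$ Suppose that (i) $f$ is convex, (ii) $D$ is $\theta$-averaged for some $\theta\in(0,1/2]$, and (iii) $\mathrm{fix}(T_{\mathrm{ADMM}})\neq\varnothing$. Then, for arbitrary $y_0,z_0\in\mathbb{R}^n$, the sequence $(x_k,y_k,z_k)_{k\ge1}$ generated by the PnP-ADMM iteration $$x_{k+1}=\mathrm{Prox}_{\rho^{-1}f}(y_k-z_k),\qquad y_{k+1}=D(x_{k+1}+z_k),\qquad z_{k+1}=z_k+x_{k+1}-y_{k+1}\qquad(k\ge0)$$ is convergent and the limit point is determined by some $u^\ast\in\mathrm{fix}(T_{\mathrm{ADMM}})$.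
   Context: Fix an inner product $\langle\cdot,\cdot\rangle$ on $\mathbb{R}^n$ with induced norm $\|x\|=\langle x,x\rangle^{1/2}$; $I$ is the identity operator on $\mathbb{R}^n$. Proximal operator: for a closed, proper, convex $h:\mathbb{R}^n\to\mathbb{R}\cup\{\infty\}$, $\mathrm{Prox}_h(x)=\arg\min_{y\in\mathbb{R}^n}\ \tfrac12\|y-x\|^2+h(y)$. Non-expansive: $T:\mathbb{R}^n\to\mathbb{R}^n$ is non-expansive if $\|T(x)-T(y)\|\le\|x-y\|$ for all $x,y\in\mathbb{R}^n$. An operator $A$ on $\mathbb{R}^n$ is $\theta$-averaged, $\theta\in(0,1)$, if $A=(1-\theta)I+\theta T$ for some non-expansive $T$. $\mathrm{fix}(T)=\{x\in\mathbb{R}^n: T(x)=x\}$ is the set of fixed points of $T:\mathbb{R}^n\to\mathbb{R}^n$. PnP-ADMM (plug-and-play ADMM) is the ADMM iteration in which the proximal operator of the regularizer is replaced by a denoiser $D$; $f$ is the data-fidelity term. *)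

theory Defs
  imports "HOL-Analysis.Analysis"
begin

text \<open>
  The inner product on \<open>real ^ 'n\<close> is arbitrary, so it is carried as an explicit argument \<open>B\<close>
  instead of being the standard one of the type class. As all norms on \<open>real ^ 'n\<close> are equivalent,
  convergence can still be expressed in the standard topology.
\<close>

definition inner_product :: "(real ^ 'n \<Rightarrow> real ^ 'n \<Rightarrow> real) \<Rightarrow> bool" where
  "inner_product B \<longleftrightarrow>
     bilinear B \<and> (\<forall>x y. B x y = B y x) \<and> (\<forall>x. x \<noteq> 0 \<longrightarrow> B x x > 0)"

definition ip_norm :: "(real ^ 'n \<Rightarrow> real ^ 'n \<Rightarrow> real) \<Rightarrow> real ^ 'n \<Rightarrow> real" where
  "ip_norm B x = sqrt (B x x)"

definition nonexpansive ::
  "(real ^ 'n \<Rightarrow> real ^ 'n \<Rightarrow> real) \<Rightarrow> (real ^ 'n \<Rightarrow> real ^ 'n) \<Rightarrow> bool" where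
  "nonexpansive B T \<longleftrightarrow> (\<forall>x y. ip_norm B (T x - T y) \<le> ip_norm B (x - y))"

definition averaged ::
  "(real ^ 'n \<Rightarrow> real ^ 'n \<Rightarrow> real) \<Rightarrow> real \<Rightarrow> (real ^ 'n \<Rightarrow> real ^ 'n) \<Rightarrow> bool" where
  "averaged B \<theta> A \<longleftrightarrow>
     0 < \<theta> \<and> \<theta> < 1 \<and>
     (\<exists>T. nonexpansive B T \<and> A = (\<lambda>x. (1 - \<theta>) *\<^sub>R x + \<theta> *\<^sub>R T x))"

text \<open>
  \<open>arg_min\<close> picks some global minimiser. For closed, proper, convex \<open>h\<close> it exists and is unique;
  for other \<open>h\<close> the value may be unspecified.
\<close>

definition prox ::
  "(real ^ 'n \<Rightarrow> real ^ 'n \<Rightarrow> real) \<Rightarrow> (real ^ 'n \<Rightarrow> ereal) \<Rightarrow> real ^ 'n \<Rightarrow> real ^ 'n" where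
  "prox B h x = arg_min (\<lambda>y. ereal (1 / 2 * (ip_norm B (y - x))\<^sup>2) + h y) (\<lambda>_. True)"

definition fixed_points :: "(real ^ 'n \<Rightarrow> real ^ 'n) \<Rightarrow> (real ^ 'n) set" where
  "fixed_points T = {x. T x = x}"

definition T_ADMM ::
  "(real ^ 'n \<Rightarrow> real ^ 'n \<Rightarrow> real) \<Rightarrow> (real ^ 'n \<Rightarrow> real) \<Rightarrow> real \<Rightarrow>
   (real ^ 'n \<Rightarrow> real ^ 'n) \<Rightarrow> real ^ 'n \<Rightarrow> real ^ 'n" where
  "T_ADMM B f \<rho> D =
     (\<lambda>u. (1 / 2) *\<^sub>R u +
        (1 / 2) *\<^sub>R ((\<lambda>v. 2 *\<^sub>R prox B (\<lambda>w. ereal (inverse \<rho> * f w)) v - v) \<circ>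
                     (\<lambda>v. 2 *\<^sub>R D v - v)) u)"

end

(*
  The sequence u_k = x_(k+1) + z_k satisfies u_(k+1) = T u_k for T = T_ADMM, with y_(k+1) = D u_k,
  z_(k+1) = u_k - D u_k and x_(k+2) = T u_k - u_k + D u_k. The reflections 2 D - I (as theta <= 1/2)
  and 2 Prox - I (firm nonexpansiveness) are nonexpansive, so T = (I + N) / 2 with N nonexpansive.
  The Krasnoselskii-Mann argument then applies: distances to fixed points decrease, the residuals
  N u_k - u_k tend to 0, and a cluster point is fixed, hence is the limit.
*)
theory Submission
  imports Defs
begin

section \<open>Identities for an arbitrary inner product\<close>

locale inner_product_operator =
  fixes B :: "real ^ 'n \<Rightarrow> real ^ 'n \<Rightarrow> real"
  assumes inner_product: "inner_product B"
begin

lemma bounded_bilinear: "bounded_bilinear B"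
  using inner_product by (simp add: inner_product_def bilinear_conv_bounded_bilinear)

sublocale bounded_bilinear B
  by (rule bounded_bilinear)

lemma sym: "B x y = B y x"
  using inner_product by (simp add: inner_product_def)

lemma pos: "x \<noteq> 0 \<Longrightarrow> B x x > 0"
  using inner_product by (simp add: inner_product_def)

lemma nonneg: "B x x \<ge> 0"
  using pos[of x] zero_left[of 0] by (cases "x = 0") (auto simp: less_imp_le)

lemma ip_norm_sq: "(ip_norm B x)\<^sup>2 = B x x"
  by (simp add: ip_norm_def nonneg)

lemma nonexpansive_iff: "nonexpansive B T \<longleftrightarrow> (\<forall>x y. B (T x - T y) (T x - T y) \<le> B (x - y) (x - y))"
  by (simp add: nonexpansive_def ip_norm_def)

lemma add_scaleR_self:
  "B (a *\<^sub>R x + b *\<^sub>R y) (a *\<^sub>R x + b *\<^sub>R y) = a\<^sup>2 * B x x + 2 * a * b * B x y + b\<^sup>2 * B y y"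
  by (simp add: add_left add_right scaleR_left scaleR_right sym[of y x] power2_eq_square algebra_simps)

text \<open>The subtracted term is the strict-convexity gain: dropping it gives nonexpansiveness of
  averages, keeping it gives the residual estimate.\<close>

lemma convex_combination_self:
  "B ((1 - t) *\<^sub>R x + t *\<^sub>R y) ((1 - t) *\<^sub>R x + t *\<^sub>R y) =
     (1 - t) * B x x + t * B y y - t * (1 - t) * B (x - y) (x - y)"
  by (simp add: add_left add_right diff_left diff_right scaleR_left scaleR_right sym[of y x]
      power2_eq_square algebra_simps)

section \<open>Comparison with the Euclidean topology\<close>

text \<open>The quadratic form attains a positive minimum on the compact Euclidean unit sphere, and
  homogeneity extends the bound to all vectors.\<close>

lemma norm_lower_bound:
  obtains c where "c > 0" "\<And>v. c * (norm v)\<^sup>2 \<le> B v v"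
proof -
  have "compact (sphere (0 :: real ^ 'n) 1)" "sphere (0 :: real ^ 'n) 1 \<noteq> {}"
    by auto
  moreover have "continuous_on (sphere 0 1) (\<lambda>v. B v v)"
    by (intro continuous_on continuous_on_id)
  ultimately obtain w where w: "w \<in> sphere 0 1" "\<And>v. v \<in> sphere 0 1 \<Longrightarrow> B w w \<le> B v v"
    using continuous_attains_inf[of "sphere 0 1" "\<lambda>v. B v v"] by blast
  have "B w w * (norm v)\<^sup>2 \<le> B v v" for v
  proof (cases "v = 0")
    case False
    then have "B w w \<le> B (v /\<^sub>R norm v) (v /\<^sub>R norm v)"
      by (intro w(2)) simp
    also have "\<dots> = B v v / (norm v)\<^sup>2"
      by (simp add: scaleR_left scaleR_right power2_eq_square divide_simps)
    finally show ?thesis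
      using False by (simp add: field_simps)
  qed (simp add: zero_left)
  moreover have "B w w > 0"
    using w(1) by (intro pos) auto
  ultimately show ?thesis
    using that by blast
qed

lemma tendsto_zero_self:
  assumes "((\<lambda>k. B (g k) (g k)) \<longlongrightarrow> 0) F"
  shows "(g \<longlongrightarrow> 0) F"
proof -
  obtain c where c: "c > 0" "\<And>v. c * (norm v)\<^sup>2 \<le> B v v"
    by (rule norm_lower_bound) blast
  have "((\<lambda>k. sqrt (B (g k) (g k) / c)) \<longlongrightarrow> sqrt (0 / c)) F"
    using assms c(1) by (intro tendsto_intros) auto
  moreover have "norm (g k) \<le> sqrt (B (g k) (g k) / c)" for k
    using c by (intro real_le_rsqrt) (simp add: field_simps)
  ultimately show ?thesis
    by (intro Lim_null_comparison[of g]) auto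
qed

text \<open>Continuity in the standard topology: the \<open>B\<close>-distance of the images is
  squeezed between 0 and that of the arguments.\<close>

lemma nonexpansive_tendsto:
  assumes "nonexpansive B T" "(g \<longlongrightarrow> l) F"
  shows "((\<lambda>k. T (g k)) \<longlongrightarrow> T l) F"
proof -
  have "((\<lambda>k. g k - l) \<longlongrightarrow> 0) F"
    using assms(2) by (simp add: LIM_zero)
  then have "((\<lambda>k. B (g k - l) (g k - l)) \<longlongrightarrow> 0) F"
    using tendsto_zero by blast
  then have "((\<lambda>k. B (T (g k) - T l) (T (g k) - T l)) \<longlongrightarrow> 0) F"
    by (rule tendsto_sandwich[OF _ _ tendsto_const, rotated 2])
       (use assms(1) nonneg in \<open>auto simp: nonexpansive_iff\<close>)
  then have "((\<lambda>k. T (g k) - T l) \<longlongrightarrow> 0) F"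
    by (rule tendsto_zero_self)
  then show ?thesis
    by (rule LIM_zero_cancel)
qed

section \<open>Proximal operators of convex functions\<close>

text \<open>Convexity lets \<open>h\<close> fall at most linearly away from \<open>x\<close>, so the
  quadratic term wins outside a large ball; inside it, continuity and compactness give a
  minimizer.\<close>

lemma prox_minimizer_exists:
  assumes h: "convex_on UNIV h"
  shows "\<exists>p. \<forall>y. 1 / 2 * B (p - x) (p - x) + h p \<le> 1 / 2 * B (y - x) (y - x) + h y"
proof -
  let ?g = "\<lambda>y. 1 / 2 * B (y - x) (y - x) + h y"
  have cont: "continuous_on S h" for S
    by (rule continuous_on_subset[OF convex_on_continuous[OF open_UNIV h]]) simp
  obtain c where c: "c > 0" "\<And>v. c * (norm v)\<^sup>2 \<le> B v v"
    by (rule norm_lower_bound) blast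
  have "\<exists>q\<in>cball x 1. \<forall>y\<in>cball x 1. h q \<le> h y"
    by (rule continuous_attains_inf) (auto intro: cont)
  then obtain q where q: "\<And>y. y \<in> cball x 1 \<Longrightarrow> h q \<le> h y"
    by blast
  define C where "C = h x - h q"
  have "C \<ge> 0"
    using q[of x] by (simp add: C_def)
  \<comment> \<open>For \<open>r > R\<close>, the summand \<open>2 * C / c\<close> gives
    \<open>c * r\<^sup>2 / 2 \<ge> r * C\<close>, so the quadratic term beats the possible loss in
    \<open>h\<close>; the summand 1 gives \<open>r > 1\<close>.\<close>
  define R where "R = 1 + 2 * C / c"
  have "R \<ge> 1"
    using \<open>C \<ge> 0\<close> c(1) by (simp add: R_def)
  have far: "?g x \<le> ?g y" if y: "y \<notin> cball x R" for y
  proof -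
    define r where "r = norm (y - x)"
    have r: "r > R" "r > 1"
      using y \<open>R \<ge> 1\<close> by (auto simp: r_def dist_norm norm_minus_commute)
    \<comment> \<open>The point of the segment from \<open>x\<close> to \<open>y\<close> at
      Euclidean distance 1 from \<open>x\<close>, where \<open>h q\<close> is a lower bound;
      convexity carries this bound out to \<open>y\<close>.\<close>
    define p where "p = (1 - 1 / r) *\<^sub>R x + (1 / r) *\<^sub>R y"
    have "p - x = (1 / r) *\<^sub>R (y - x)"
      by (simp add: p_def algebra_simps)
    then have "norm (p - x) = (1 / r) * r"
      using r(2) by (simp only: norm_scaleR flip: r_def) simp
    then have "norm (p - x) = 1"
      using r(2) by simp
    then have "h q \<le> h p"
      by (intro q) (simp add: dist_norm norm_minus_commute)
    also have "h p \<le> (1 - 1 / r) * h x + (1 / r) * h y"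
      unfolding p_def using r by (intro convex_onD[OF h]) auto
    finally have "r * h q \<le> r * ((1 - 1 / r) * h x + (1 / r) * h y)"
      using r by (intro mult_left_mono) auto
    also have "\<dots> = (r - 1) * h x + h y"
      using r by (simp add: field_simps)
    finally have hy: "h x - r * C \<le> h y"
      by (simp add: C_def algebra_simps)
    have "2 * C / c \<le> r"
      using r(1) by (simp add: R_def)
    then have "2 * C \<le> c * r"
      using c(1) by (simp add: field_simps)
    then have "r * (2 * C) \<le> r * (c * r)"
      using r by (intro mult_left_mono) auto
    moreover have "c * r\<^sup>2 \<le> B (y - x) (y - x)"
      unfolding r_def by (rule c(2))
    ultimately show ?thesis
      using hy by (simp add: power2_eq_square zero_left algebra_simps)
  qed
  have "\<exists>p\<in>cball x R. \<forall>y\<in>cball x R. ?g p \<le> ?g y"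
    by (rule continuous_attains_inf)
       (use \<open>R \<ge> 1\<close> in \<open>auto intro!: continuous_intros continuous_on cont\<close>)
  then obtain p where p: "\<And>y. y \<in> cball x R \<Longrightarrow> ?g p \<le> ?g y"
    by blast
  have "?g p \<le> ?g y" for y
  proof (cases "y \<in> cball x R")
    case False
    have "?g p \<le> ?g x"
      using \<open>R \<ge> 1\<close> by (intro p) simp
    also have "\<dots> \<le> ?g y"
      using False by (rule far)
    finally show ?thesis .
  qed (rule p)
  then show ?thesis
    by blast
qed

text \<open>Existence of a minimizer makes the choice in \<open>arg_min\<close> meaningful; the
  inequality then passes from \<open>ereal\<close> to the reals.\<close>

lemma prox_minimal:
  assumes "convex_on UNIV h"
  shows "1 / 2 * B (prox B h x - x) (prox B h x - x) + h (prox B h x)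
    \<le> 1 / 2 * B (y - x) (y - x) + h y"
proof -
  let ?G = "\<lambda>y. ereal (1 / 2 * (ip_norm B (y - x))\<^sup>2) + ereal (h y)"
  have "\<exists>p. is_arg_min ?G (\<lambda>_. True) p"
    using prox_minimizer_exists[OF assms, of x] by (auto simp: is_arg_min_def ip_norm_sq not_less)
  then have "is_arg_min ?G (\<lambda>_. True) (prox B h x)"
    unfolding prox_def arg_min_def by (rule someI_ex)
  then show ?thesis
    by (auto simp: is_arg_min_def ip_norm_sq not_less)
qed

text \<open>First-order optimality without derivatives: compare the minimizer with points on the
  segment towards \<open>y\<close>, divide by the step length and let it tend to 0.\<close>

lemma prox_variational_inequality:
  assumes h: "convex_on UNIV h"
  shows "B (x - prox B h x) (y - prox B h x) \<le> h y - h (prox B h x)"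
proof -
  define p where "p = prox B h x"
  define a where "a = B (x - p) (y - p)"
  define b where "b = B (y - p) (y - p)"
  have "a \<le> h y - h p + t / 2 * b" if t: "0 < t" "t < 1" for t
  proof -
    define w where "w = (1 - t) *\<^sub>R p + t *\<^sub>R y"
    have w: "w - x = 1 *\<^sub>R (p - x) + t *\<^sub>R (y - p)"
      by (simp add: w_def algebra_simps)
    have "B (w - x) (w - x) = B (p - x) (p - x) - 2 * t * a + t\<^sup>2 * b"
      unfolding w add_scaleR_self by (simp add: a_def b_def diff_left algebra_simps)
    moreover have "h w \<le> (1 - t) * h p + t * h y"
      unfolding w_def using t by (intro convex_onD[OF h]) auto
    moreover have "1 / 2 * B (p - x) (p - x) + h p \<le> 1 / 2 * B (w - x) (w - x) + h w"
      unfolding p_def by (rule prox_minimal[OF h])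
    ultimately have "t * a \<le> t * (h y - h p + t / 2 * b)"
      by (simp add: power2_eq_square algebra_simps)
    then show ?thesis
      using t by simp
  qed
  then have "\<forall>\<^sub>F t in at_right 0. a \<le> h y - h p + t / 2 * b"
    unfolding eventually_at_right_field by (intro exI[of _ 1]) auto
  moreover have "((\<lambda>t. h y - h p + t / 2 * b) \<longlongrightarrow> h y - h p + 0 / 2 * b) (at_right 0)"
    by (intro tendsto_intros) auto
  ultimately have "a \<le> h y - h p + 0 / 2 * b"
    by (intro tendsto_lowerbound[of _ _ "at_right 0"]) auto
  then show ?thesis
    by (simp add: a_def p_def)
qed

text \<open>Adding the variational inequalities at \<open>v\<close> and \<open>w\<close> yields firm
  nonexpansiveness, which makes the extra terms in the expanded square of the reflection
  nonpositive.\<close>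

lemma prox_reflection_nonexpansive:
  assumes h: "convex_on UNIV h"
  shows "nonexpansive B (\<lambda>v. 2 *\<^sub>R prox B h v - v)"
  unfolding nonexpansive_iff
proof (intro allI)
  fix v w
  define p q where "p = prox B h v" and "q = prox B h w"
  have "B (v - p) (q - p) \<le> h q - h p" "B (w - q) (p - q) \<le> h p - h q"
    unfolding p_def q_def by (rule prox_variational_inequality[OF h])+
  then have firm: "B (p - q) (p - q) \<le> B (p - q) (v - w)"
    by (simp add: diff_left diff_right sym[of q p] sym[of v] sym[of w] algebra_simps)
  have eq: "2 *\<^sub>R p - v - (2 *\<^sub>R q - w) = 2 *\<^sub>R (p - q) + (-1) *\<^sub>R (v - w)"
    by (simp add: algebra_simps)
  show "B (2 *\<^sub>R prox B h v - v - (2 *\<^sub>R prox B h w - w)) (2 *\<^sub>R prox B h v - v - (2 *\<^sub>R prox B h w - w))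
      \<le> B (v - w) (v - w)"
    unfolding p_def[symmetric] q_def[symmetric] eq add_scaleR_self using firm by simp
qed

section \<open>Averaged operators\<close>

text \<open>The reflection is \<open>(1 - 2 * \<theta>) I + (2 * \<theta>) S\<close>, a genuine
  convex combination exactly because \<open>\<theta> \<le> 1 / 2\<close>.\<close>

lemma averaged_reflection_nonexpansive:
  assumes "averaged B \<theta> A" "\<theta> \<le> 1 / 2"
  shows "nonexpansive B (\<lambda>v. 2 *\<^sub>R A v - v)"
proof -
  obtain S where S: "nonexpansive B S" and A: "A = (\<lambda>x. (1 - \<theta>) *\<^sub>R x + \<theta> *\<^sub>R S x)" and "0 < \<theta>"
    using assms(1) by (auto simp: averaged_def)
  show ?thesis
    unfolding nonexpansive_iff
  proof (intro allI)
    fix v w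
    have eq: "2 *\<^sub>R A v - v - (2 *\<^sub>R A w - w) = (1 - 2 * \<theta>) *\<^sub>R (v - w) + (2 * \<theta>) *\<^sub>R (S v - S w)"
      unfolding A by (simp add: algebra_simps scaleR_2 flip: scaleR_left.add)
    have "B (S v - S w) (S v - S w) \<le> B (v - w) (v - w)"
      using S by (simp add: nonexpansive_iff)
    then have "(2 * \<theta>) * B (S v - S w) (S v - S w) \<le> (2 * \<theta>) * B (v - w) (v - w)"
      using \<open>0 < \<theta>\<close> by (intro mult_left_mono) auto
    moreover have "0 \<le> 2 * \<theta> * (1 - 2 * \<theta>) * B (v - w - (S v - S w)) (v - w - (S v - S w))"
      using \<open>0 < \<theta>\<close> assms(2) by (intro mult_nonneg_nonneg nonneg) auto
    ultimately show "B (2 *\<^sub>R A v - v - (2 *\<^sub>R A w - w)) (2 *\<^sub>R A v - v - (2 *\<^sub>R A w - w))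
        \<le> B (v - w) (v - w)"
      unfolding eq convex_combination_self by (simp add: algebra_simps)
  qed
qed

text \<open>Supplies the continuity of the denoiser when passing to the limit in the
  iteration.\<close>

lemma averaged_nonexpansive:
  assumes "averaged B \<theta> A"
  shows "nonexpansive B A"
proof -
  obtain S where S: "nonexpansive B S" and A: "A = (\<lambda>x. (1 - \<theta>) *\<^sub>R x + \<theta> *\<^sub>R S x)"
    and "0 < \<theta>" "\<theta> < 1"
    using assms(1) by (auto simp: averaged_def)
  show ?thesis
    unfolding nonexpansive_iff
  proof (intro allI)
    fix v w
    have eq: "A v - A w = (1 - \<theta>) *\<^sub>R (v - w) + \<theta> *\<^sub>R (S v - S w)"
      unfolding A by (simp add: algebra_simps)
    have "B (S v - S w) (S v - S w) \<le> B (v - w) (v - w)"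
      using S by (simp add: nonexpansive_iff)
    then have "\<theta> * B (S v - S w) (S v - S w) \<le> \<theta> * B (v - w) (v - w)"
      using \<open>0 < \<theta>\<close> by (intro mult_left_mono) auto
    moreover have "0 \<le> \<theta> * (1 - \<theta>) * B (v - w - (S v - S w)) (v - w - (S v - S w))"
      using \<open>0 < \<theta>\<close> \<open>\<theta> < 1\<close> by (intro mult_nonneg_nonneg nonneg) auto
    ultimately show "B (A v - A w) (A v - A w) \<le> B (v - w) (v - w)"
      unfolding eq convex_combination_self by (simp add: algebra_simps)
  qed
qed

section \<open>Krasnoselskii-Mann iteration\<close>

text \<open>In the convex combination of \<open>v - w\<close> and \<open>N v - w\<close>, the
  difference of the two vectors is the residual \<open>v - N v\<close>, so each step gains a
  multiple of its square.\<close>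

lemma averaged_dist_fixed_point:
  assumes "nonexpansive B N" "N w = w" "0 \<le> \<theta>"
  shows "B ((1 - \<theta>) *\<^sub>R v + \<theta> *\<^sub>R N v - w) ((1 - \<theta>) *\<^sub>R v + \<theta> *\<^sub>R N v - w)
    \<le> B (v - w) (v - w) - \<theta> * (1 - \<theta>) * B (v - N v) (v - N v)"
proof -
  have eq: "(1 - \<theta>) *\<^sub>R v + \<theta> *\<^sub>R N v - w = (1 - \<theta>) *\<^sub>R (v - w) + \<theta> *\<^sub>R (N v - w)"
    by (simp add: algebra_simps)
  have "B (N v - w) (N v - w) \<le> B (v - w) (v - w)"
    using assms(1,2) unfolding nonexpansive_iff by metis
  then have "\<theta> * B (N v - w) (N v - w) \<le> \<theta> * B (v - w) (v - w)"
    using assms(3) by (rule mult_left_mono)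
  then show ?thesis
    unfolding eq convex_combination_self by (simp add: algebra_simps)
qed

theorem Krasnoselskii_Mann:
  assumes N: "nonexpansive B N" and ex: "\<exists>w. N w = w" and \<theta>: "0 < \<theta>" "\<theta> < 1"
    and u: "\<And>k. u (Suc k) = (1 - \<theta>) *\<^sub>R u k + \<theta> *\<^sub>R N (u k)"
  obtains l where "N l = l" "u \<longlonglongrightarrow> l"
proof -
  define d where "d w k = B (u k - w) (u k - w)" for w k
  define r where "r k = B (u k - N (u k)) (u k - N (u k))" for k
  have step: "d w (Suc k) \<le> d w k - \<theta> * (1 - \<theta>) * r k" if "N w = w" for w k
    unfolding d_def r_def u using averaged_dist_fixed_point[OF N that] \<theta> by auto
  have r: "r k \<ge> 0" for k
    by (simp add: r_def nonneg)
  have decr: "decseq (d w)" if "N w = w" for w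
  proof (rule decseq_SucI)
    fix k
    have "0 \<le> \<theta> * (1 - \<theta>) * r k"
      using \<theta> r by simp
    then show "d w (Suc k) \<le> d w k"
      using step[OF that, of k] by linarith
  qed
  have d_conv: "convergent (d w)" if "N w = w" for w
    using decseq_convergent[OF decr[OF that], of 0] by (auto simp: d_def nonneg convergent_def)
  obtain w where w: "N w = w"
    using ex by blast

  obtain L where "d w \<longlonglongrightarrow> L"
    using d_conv[OF w] by (auto simp: convergent_def)
  \<comment> \<open>Successive differences of a convergent sequence vanish, and by
    \<open>step\<close> these quotients dominate the residuals.\<close>
  then have "(\<lambda>k. (d w k - d w (Suc k)) / (\<theta> * (1 - \<theta>))) \<longlonglongrightarrow> (L - L) / (\<theta> * (1 - \<theta>))"
    using \<theta> by (intro tendsto_intros) (auto intro: LIMSEQ_Suc)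
  then have "(\<lambda>k. (d w k - d w (Suc k)) / (\<theta> * (1 - \<theta>))) \<longlonglongrightarrow> 0"
    by simp
  moreover have "r k \<le> (d w k - d w (Suc k)) / (\<theta> * (1 - \<theta>))" for k
    using step[OF w, of k] \<theta> by (simp add: field_simps)
  ultimately have "r \<longlonglongrightarrow> 0"
    by (intro Lim_null_comparison[of r]) (simp_all add: r)
  then have res: "(\<lambda>k. u k - N (u k)) \<longlonglongrightarrow> 0"
    unfolding r_def by (rule tendsto_zero_self)

  obtain c where c: "c > 0" "\<And>v. c * (norm v)\<^sup>2 \<le> B v v"
    by (rule norm_lower_bound) blast
  have "dist w (u k) \<le> sqrt (d w 0 / c)" for k
  proof -
    have "c * (norm (u k - w))\<^sup>2 \<le> d w 0"
      using c(2)[of "u k - w"] decseqD[OF decr[OF w], of 0 k] by (simp add: d_def)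
    then show ?thesis
      using c(1) by (intro real_le_rsqrt) (simp add: field_simps dist_norm norm_minus_commute)
  qed
  then have "bounded (range u)"
    unfolding bounded_def by blast
  then obtain l s where s: "strict_mono (s :: nat \<Rightarrow> nat)" and l: "(u \<circ> s) \<longlonglongrightarrow> l"
    using bounded_imp_convergent_subsequence by blast
  have "(\<lambda>k. (u \<circ> s) k - N ((u \<circ> s) k)) \<longlonglongrightarrow> l - N l"
    by (intro tendsto_diff l nonexpansive_tendsto[OF N])
  moreover have "(\<lambda>k. (u \<circ> s) k - N ((u \<circ> s) k)) \<longlonglongrightarrow> 0"
    using LIMSEQ_subseq_LIMSEQ[OF res s] by (simp add: o_def)
  ultimately have "l - N l = 0"
    by (rule LIMSEQ_unique)
  then have "N l = l"
    by simp
  \<comment> \<open>Since the cluster point \<open>l\<close> is itself fixed, the distances to it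
    converge along the whole sequence; the subsequence forces their limit to be 0.\<close>
  obtain M where M: "d l \<longlonglongrightarrow> M"
    using d_conv[OF \<open>N l = l\<close>] by (auto simp: convergent_def)
  have "(\<lambda>k. (u \<circ> s) k - l) \<longlonglongrightarrow> 0"
    using l by (rule LIM_zero)
  then have "(\<lambda>k. B ((u \<circ> s) k - l) ((u \<circ> s) k - l)) \<longlonglongrightarrow> 0"
    using tendsto_zero by blast
  then have "(d l \<circ> s) \<longlonglongrightarrow> 0"
    by (simp add: d_def o_def)
  then have "M = 0"
    using LIMSEQ_subseq_LIMSEQ[OF M s] LIMSEQ_unique by blast
  then have "(\<lambda>k. u k - l) \<longlonglongrightarrow> 0"
    using M unfolding d_def by (intro tendsto_zero_self) simp
  then show ?thesis
    using that[OF \<open>N l = l\<close>] LIM_zero_cancel by blast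
qed

end

section \<open>The PnP-ADMM operator and convergence of the iteration\<close>

lemma nonexpansive_comp:
  assumes "nonexpansive B S" "nonexpansive B T"
  shows "nonexpansive B (S \<circ> T)"
  using assms unfolding nonexpansive_def o_def by (meson order_trans)

text \<open>Expanding the reflections exposes the ADMM variables: for \<open>u = u k\<close>,
  \<open>u - D u\<close> is the new \<open>z\<close> and the proximal term is the following
  \<open>x\<close>.\<close>

lemma T_ADMM_eq:
  "T_ADMM B f \<rho> D u = u - D u + prox B (\<lambda>w. ereal (inverse \<rho> * f w)) (2 *\<^sub>R D u - u)"
proof -
  have "u = (1 / 2) *\<^sub>R u + (1 / 2) *\<^sub>R u"
    by (simp flip: scaleR_left.add)
  then show ?thesis
    by (simp add: T_ADMM_def scaleR_right_diff_distrib algebra_simps)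
qed

theorem mainTheorem2:
  fixes B :: "real ^ 'n \<Rightarrow> real ^ 'n \<Rightarrow> real"
    and f :: "real ^ 'n \<Rightarrow> real"
    and D :: "real ^ 'n \<Rightarrow> real ^ 'n"
    and \<rho> \<theta> :: real
    and y0 z0 :: "real ^ 'n"
    and x y z :: "nat \<Rightarrow> real ^ 'n"
  assumes "inner_product B"
    and "\<rho> > 0"
    and "convex_on UNIV f"
    and "0 < \<theta>" and "\<theta> \<le> 1 / 2" and "averaged B \<theta> D"
    and "fixed_points (T_ADMM B f \<rho> D) \<noteq> {}"
    and "y 0 = y0" and "z 0 = z0"
    and "\<And>k. x (Suc k) = prox B (\<lambda>w. ereal (inverse \<rho> * f w)) (y k - z k)"
    and "\<And>k. y (Suc k) = D (x (Suc k) + z k)"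
    and "\<And>k. z (Suc k) = z k + x (Suc k) - y (Suc k)"
  shows "\<exists>u \<in> fixed_points (T_ADMM B f \<rho> D).
           (\<lambda>k. (x (Suc k), y (Suc k), z (Suc k))) \<longlonglongrightarrow> (D u, D u, u - D u)"
proof -
  let ?P = "prox B (\<lambda>w. ereal (inverse \<rho> * f w))"
  let ?T = "T_ADMM B f \<rho> D"
  interpret inner_product_operator B
    using assms(1) by unfold_locales
  define N where "N = (\<lambda>v. 2 *\<^sub>R ?P v - v) \<circ> (\<lambda>v. 2 *\<^sub>R D v - v)"
  have "convex_on UNIV (\<lambda>w. inverse \<rho> * f w)"
    using assms(2,3) by (intro convex_on_cmul) auto
  then have N: "nonexpansive B N"
    unfolding N_def using assms(5,6)
    by (intro nonexpansive_comp prox_reflection_nonexpansive averaged_reflection_nonexpansive)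
  have T: "?T v = (1 - 1 / 2) *\<^sub>R v + (1 / 2) *\<^sub>R N v" for v
    by (simp add: T_ADMM_def N_def)
  \<comment> \<open>Averaging with the identity preserves fixed points, so the limit found for
    \<open>N\<close> is one for \<open>?T\<close>.\<close>
  have fixed: "v \<in> fixed_points ?T \<longleftrightarrow> N v = v" for v
  proof -
    have "?T v = v \<longleftrightarrow> (1 / 2) *\<^sub>R N v = (1 / 2) *\<^sub>R v"
      unfolding T by (metis add_diff_cancel_left' scaleR_collapse)
    then show ?thesis
      by (simp add: fixed_points_def)
  qed

  \<comment> \<open>The argument of \<open>D\<close> in the \<open>y\<close>-update. The shifted
    index starts the sequence after the first proximal step, so \<open>y0\<close> and
    \<open>z0\<close> may be arbitrary.\<close>
  define u where "u k = x (Suc k) + z k" for k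
  have y: "y (Suc k) = D (u k)" and z: "z (Suc k) = u k - D (u k)" for k
    by (simp_all add: u_def assms(11,12))
  \<comment> \<open>Here \<open>y (Suc k) - z (Suc k)\<close> is the reflection of
    \<open>u k\<close> through \<open>D\<close>.\<close>
  have "x (Suc (Suc k)) = ?P (2 *\<^sub>R D (u k) - u k)" for k
    unfolding assms(10)[of "Suc k"] y z by (simp add: scaleR_2)
  then have uT: "u (Suc k) = ?T (u k)" for k
    by (simp add: u_def[of "Suc k"] z T_ADMM_eq)
  have "\<exists>w. N w = w"
    using assms(7) fixed by auto
  then obtain l where l: "N l = l" "u \<longlonglongrightarrow> l"
    using Krasnoselskii_Mann[OF N, of "1 / 2" u] by (auto simp: uT T)
  have Du: "(\<lambda>k. D (u k)) \<longlonglongrightarrow> D l"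
    by (rule nonexpansive_tendsto[OF averaged_nonexpansive[OF assms(6)] l(2)])
  have zl: "(\<lambda>k. z (Suc k)) \<longlonglongrightarrow> l - D l"
    unfolding z by (intro tendsto_intros Du l)
  \<comment> \<open>The unshifted sequence is wanted because
    \<open>x (Suc k) = u k - z k\<close>.\<close>
  then have "z \<longlonglongrightarrow> l - D l"
    by (simp add: LIMSEQ_imp_Suc)
  then have "(\<lambda>k. u k - z k) \<longlonglongrightarrow> l - (l - D l)"
    by (intro tendsto_intros l)
  then have "(\<lambda>k. x (Suc k)) \<longlonglongrightarrow> D l"
    by (simp add: u_def)
  moreover have "(\<lambda>k. y (Suc k)) \<longlonglongrightarrow> D l"
    unfolding y by (rule Du)
  ultimately have "(\<lambda>k. (x (Suc k), y (Suc k), z (Suc k))) \<longlonglongrightarrow> (D l, D l, l - D l)"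
    using zl by (intro tendsto_Pair)
  then show ?thesis
    using l(1) fixed by blast
qed

end
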